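(* Let $E$ be a finite set with $|E|=n$, and let $\psi:2^E\to\mathbb{R}$ be a submodular function that is bounded from below by a given $-M$, i.e. $M>0$ and $\psi(A)\ge -M$ for all $A\subseteq E$. Then a subset of $E$ minimizing $\psi$ can be identified by applying the grouping algorithm $n$ times; consequently there is an algorithm that computes a set $A^*\subseteq E$ with $\psi(A^* )=\min_{A\subseteq E}\psi(A)$ with overall computational effort $O(n^4\,LP(n))$.
   Context: A set function $\psi:2^E\to\mathbb{R}$ is submodular if $\psi(A)+\psi(B)\ge\psi(A\cup B)+\psi(A\cap B)$ for all $A,B\subseteq E$. $LP(n)$ denotes the computational effort of solving a linear program with no more than $n$ variables and $n$ constraints. Values of $\psi$ are available by evaluation (value oracle), each evaluation and each elementary arithmetic operation or comparison being counted as a unit operation. The grouping algorithm is an algorithm for the following problem. Input: a finite ground set with an ordering of its elements (a listing $e_1,\dots,e_n$), a set function $f\ge0$ on its subsets with $f(\emptyset)=0$ that is increasing ($A\subseteq B\Rightarrow f(A)\le f(B)$) and submodular, and a vector $d\ge 0$ with $d(A):=\sum_{i\in A}d_i\le f(A)$ for all $A$. Output: a partition of the ground set into ordered groups $G_1,\dots,G_m$, with one lead element $\ell_i\in G_i$ in each, and the vector $x$ with $x_k=d_k$ for non-lead $k$ and $x_{\ell_i}=f(G^{(i)})-f(G^{(i-1)})-d(G_i\setminus\{\ell_i\})$, where $G^{(i)}=G_1\cup\cdots\cup G_i$, $G^{(0)}=\emptyset$, such that $x_{\ell_i}\ge d_{\ell_i}$ and $\sum_{k\in A}x_k\le f(G^{(i-1)}\cup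 A)-f(G^{(i-1)})$ for all $A\subset G_i$, and such that in the given ordering the leads appear in the order $\ell_1,\ell_2,\dots,\ell_m$ and each lead precedes the other elements of its group. The computational effort of one application is $O(n^3\,LP(n))$. *)

theory Defs
  imports Complex_Main "HOL-Library.Landau_Symbols"
begin

section \<open>Set functions\<close>

definition submodular_on :: "'a set \<Rightarrow> ('a set \<Rightarrow> real) \<Rightarrow> bool" where
  "submodular_on V f \<longleftrightarrow>
     (\<forall>A B. A \<subseteq> V \<longrightarrow> B \<subseteq> V \<longrightarrow> f A + f B \<ge> f (A \<union> B) + f (A \<inter> B))"

definition increasing_on :: "'a set \<Rightarrow> ('a set \<Rightarrow> real) \<Rightarrow> bool" where
  "increasing_on V f \<longleftrightarrow> (\<forall>A B. A \<subseteq> B \<longrightarrow> B \<subseteq> V \<longrightarrow> f A \<le> f B)"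


section \<open>The grouping problem\<close>

text \<open>
  The ground set is \<open>{..<n}\<close>.  Its ordering is the listing \<open>ord 0, \<dots>, ord (n - 1)\<close>,
  which need not be the numerical order.
\<close>

definition grouping_input ::
  "nat \<Rightarrow> (nat \<Rightarrow> nat) \<Rightarrow> (nat set \<Rightarrow> real) \<Rightarrow> (nat \<Rightarrow> real) \<Rightarrow> bool" where
  "grouping_input n ord f d \<longleftrightarrow>
     bij_betw ord {..<n} {..<n} \<and>
     (\<forall>A \<subseteq> {..<n}. 0 \<le> f A) \<and> f {} = 0 \<and>
     increasing_on {..<n} f \<and> submodular_on {..<n} f \<and>
     (\<forall>i<n. 0 \<le> d i) \<and> (\<forall>A \<subseteq> {..<n}. sum d A \<le> f A)"

definition precedes :: "nat \<Rightarrow> (nat \<Rightarrow> nat) \<Rightarrow> nat \<Rightarrow> nat \<Rightarrow> bool" where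
  "precedes n ord a b \<longleftrightarrow> (\<exists>i j. i < j \<and> j < n \<and> ord i = a \<and> ord j = b)"

text \<open>
  Groups are numbered from 0: \<open>G i\<close> and \<open>lead i\<close>, for \<open>i < m\<close>, are the paper's
  $G_{i+1}$ and $\ell_{i+1}$, and \<open>(\<Union>j<i. G j)\<close> is $G^{(i)}$.
\<close>

definition grouping_output ::
  "nat \<Rightarrow> (nat \<Rightarrow> nat) \<Rightarrow> (nat set \<Rightarrow> real) \<Rightarrow> (nat \<Rightarrow> real) \<Rightarrow>
   nat \<Rightarrow> (nat \<Rightarrow> nat) \<Rightarrow> (nat \<Rightarrow> nat set) \<Rightarrow> (nat \<Rightarrow> real) \<Rightarrow> bool" where
  "grouping_output n ord f d m lead G x \<longleftrightarrow>
     (\<Union>i<m. G i) = {..<n} \<and>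
     (\<forall>i<m. \<forall>j<m. i \<noteq> j \<longrightarrow> G i \<inter> G j = {}) \<and>
     (\<forall>i<m. lead i \<in> G i) \<and>
     (\<forall>k<n. k \<notin> lead ` {..<m} \<longrightarrow> x k = d k) \<and>
     (\<forall>i<m. x (lead i) = f (\<Union>j<Suc i. G j) - f (\<Union>j<i. G j) - sum d (G i - {lead i})) \<and>
     (\<forall>i<m. x (lead i) \<ge> d (lead i)) \<and>
     (\<forall>i<m. \<forall>A \<subseteq> G i. sum x A \<le> f ((\<Union>j<i. G j) \<union> A) - f (\<Union>j<i. G j)) \<and>
     (\<forall>i<m. \<forall>j<m. i < j \<longrightarrow> precedes n ord (lead i) (lead j)) \<and>
     (\<forall>i<m. \<forall>k \<in> G i - {lead i}. precedes n ord (lead i) k)"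


section \<open>Linear programs\<close>

text \<open>
  The program with data \<open>c\<close>, \<open>A\<close>, \<open>b\<close> is: maximize \<open>c \<bullet> y\<close> subject to \<open>A y \<le> b\<close>,
  with one free real variable for each entry of \<open>c\<close> and one constraint for each row of \<open>A\<close>.
\<close>

datatype lp_result = Optimal "real list" | Infeasible | Unbounded

type_synonym lp_solver = "real list \<Rightarrow> real list list \<Rightarrow> real list \<Rightarrow> lp_result"

definition inner_list :: "real list \<Rightarrow> real list \<Rightarrow> real" where
  "inner_list u v = (\<Sum>j<length u. u ! j * v ! j)"

definition lp_feasible :: "nat \<Rightarrow> real list list \<Rightarrow> real list \<Rightarrow> real list \<Rightarrow> bool" where
  "lp_feasible p A b y \<longleftrightarrow>
     length y = p \<and> (\<forall>i<length A. inner_list (A ! i) y \<le> b ! i)"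

definition correct_lp_solver :: "lp_solver \<Rightarrow> bool" where
  "correct_lp_solver lps \<longleftrightarrow>
     (\<forall>c A b. length b = length A \<longrightarrow> (\<forall>row \<in> set A. length row = length c) \<longrightarrow>
        (case lps c A b of
           Optimal y \<Rightarrow> lp_feasible (length c) A b y \<and>
             (\<forall>z. lp_feasible (length c) A b z \<longrightarrow> inner_list c z \<le> inner_list c y)
         | Infeasible \<Rightarrow> \<not> (\<exists>z. lp_feasible (length c) A b z)
         | Unbounded \<Rightarrow> (\<forall>B. \<exists>z. lp_feasible (length c) A b z \<and> inner_list c z > B)))"


section \<open>The model of computation\<close>

text \<open>
  An algorithm is one finite program, the same for all input sizes, over three kinds of arrays:
  of natural numbers, of sets of natural numbers, and of reals.  The elements of a ground set
  are represented by their indices \<open>0, \<dots>, n - 1\<close>.  Every operation on any of the three sorts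
  counts as one unit operation; this includes forming a union and taking a cardinality.  There
  is no rounding of reals and no multiplication or division of natural numbers, whose unit-cost
  use on large numbers would be unrealistic.
\<close>

type_synonym vname = string

record state =
  nat_arr :: "vname \<Rightarrow> nat \<Rightarrow> nat"
  set_arr :: "vname \<Rightarrow> nat \<Rightarrow> nat set"
  real_arr :: "vname \<Rightarrow> nat \<Rightarrow> real"

definition init_state :: state where
  "init_state = \<lparr>nat_arr = (\<lambda>_ _. 0), set_arr = (\<lambda>_ _. {}), real_arr = (\<lambda>_ _. 0)\<rparr>"

definition setN :: "vname \<Rightarrow> nat \<Rightarrow> nat \<Rightarrow> state \<Rightarrow> state" where
  "setN v i a s = s\<lparr>nat_arr := (nat_arr s)(v := (nat_arr s v)(i := a))\<rparr>"

definition setS :: "vname \<Rightarrow> nat \<Rightarrow> nat set \<Rightarrow> state \<Rightarrow> state" where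
  "setS v i a s = s\<lparr>set_arr := (set_arr s)(v := (set_arr s v)(i := a))\<rparr>"

definition setR :: "vname \<Rightarrow> nat \<Rightarrow> real \<Rightarrow> state \<Rightarrow> state" where
  "setR v i a s = s\<lparr>real_arr := (real_arr s)(v := (real_arr s v)(i := a))\<rparr>"

datatype nexp = NNum nat | NVar vname nexp | NAdd nexp nexp | NSub nexp nexp | NCard sexp
  and sexp = SEmpty | SVar vname nexp | SInsert nexp sexp
    | SUnion sexp sexp | SInter sexp sexp | SDiff sexp sexp

datatype rexp = RNum int | RVar vname nexp | RNat nexp
  | RAdd rexp rexp | RSub rexp rexp | RMul rexp rexp | RDiv rexp rexp

datatype bexp = BLeN nexp nexp | BLeR rexp rexp | BMem nexp sexp
  | BNot bexp | BAnd bexp bexp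

primrec nval :: "state \<Rightarrow> nexp \<Rightarrow> nat" and sval :: "state \<Rightarrow> sexp \<Rightarrow> nat set" where
  "nval s (NNum a) = a"
| "nval s (NVar v i) = nat_arr s v (nval s i)"
| "nval s (NAdd a b) = nval s a + nval s b"
| "nval s (NSub a b) = nval s a - nval s b"
| "nval s (NCard A) = card (sval s A)"
| "sval s SEmpty = {}"
| "sval s (SVar v i) = set_arr s v (nval s i)"
| "sval s (SInsert a A) = insert (nval s a) (sval s A)"
| "sval s (SUnion A B) = sval s A \<union> sval s B"
| "sval s (SInter A B) = sval s A \<inter> sval s B"
| "sval s (SDiff A B) = sval s A - sval s B"

primrec rval :: "state \<Rightarrow> rexp \<Rightarrow> real" where
  "rval s (RNum a) = of_int a"
| "rval s (RVar v i) = real_arr s v (nval s i)"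
| "rval s (RNat a) = real (nval s a)"
| "rval s (RAdd a b) = rval s a + rval s b"
| "rval s (RSub a b) = rval s a - rval s b"
| "rval s (RMul a b) = rval s a * rval s b"
| "rval s (RDiv a b) = rval s a / rval s b"

primrec bval :: "state \<Rightarrow> bexp \<Rightarrow> bool" where
  "bval s (BLeN a b) = (nval s a \<le> nval s b)"
| "bval s (BLeR a b) = (rval s a \<le> rval s b)"
| "bval s (BMem a A) = (nval s a \<in> sval s A)"
| "bval s (BNot b) = (\<not> bval s b)"
| "bval s (BAnd a b) = (bval s a \<and> bval s b)"

text \<open>The number of unit operations in an expression: one for each node.\<close>

primrec nops :: "nexp \<Rightarrow> nat" and sops :: "sexp \<Rightarrow> nat" where
  "nops (NNum a) = 1"
| "nops (NVar v i) = 1 + nops i"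
| "nops (NAdd a b) = 1 + nops a + nops b"
| "nops (NSub a b) = 1 + nops a + nops b"
| "nops (NCard A) = 1 + sops A"
| "sops SEmpty = 1"
| "sops (SVar v i) = 1 + nops i"
| "sops (SInsert a A) = 1 + nops a + sops A"
| "sops (SUnion A B) = 1 + sops A + sops B"
| "sops (SInter A B) = 1 + sops A + sops B"
| "sops (SDiff A B) = 1 + sops A + sops B"

primrec rops :: "rexp \<Rightarrow> nat" where
  "rops (RNum a) = 1"
| "rops (RVar v i) = 1 + nops i"
| "rops (RNat a) = 1 + nops a"
| "rops (RAdd a b) = 1 + rops a + rops b"
| "rops (RSub a b) = 1 + rops a + rops b"
| "rops (RMul a b) = 1 + rops a + rops b"
| "rops (RDiv a b) = 1 + rops a + rops b"

primrec bops :: "bexp \<Rightarrow> nat" where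
  "bops (BLeN a b) = 1 + nops a + nops b"
| "bops (BLeR a b) = 1 + rops a + rops b"
| "bops (BMem a A) = 1 + nops a + sops A"
| "bops (BNot b) = 1 + bops b"
| "bops (BAnd a b) = 1 + bops a + bops b"

text \<open>
  \<open>Eval v i A\<close> stores the value of the given set function at the set \<open>A\<close> in entry \<open>i\<close> of the real array \<open>v\<close>.
  \<open>SolveLP p q\<close> solves a linear program with \<open>p\<close> variables and \<open>q\<close> constraints.
  \<open>Group e\<close> applies the grouping algorithm; the program \<open>e\<close> evaluates the set function
  to which it is applied.
\<close>

datatype com =
    Skip
  | NAsg vname nexp nexp
  | SAsg vname nexp sexp
  | RAsg vname nexp rexp
  | Eval vname nexp sexp
  | SolveLP nexp nexp
  | Group com
  | Seq com com
  | Cond bexp com com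
  | While bexp com

text \<open>
  The data of a linear program are read from the arrays \<open>lp_c\<close>, \<open>lp_A\<close> (row by row) and \<open>lp_b\<close>;
  \<open>lp_status\<close> receives 0, 1 or 2 for optimal, infeasible or unbounded, and \<open>lp_y\<close> an
  optimal solution, if there is one.
\<close>

definition lp_call :: "lp_solver \<Rightarrow> nat \<Rightarrow> nat \<Rightarrow> state \<Rightarrow> state" where
  "lp_call lps p q s =
     (case lps (map (real_arr s ''lp_c'') [0..<p])
               (map (\<lambda>i. map (\<lambda>j. real_arr s ''lp_A'' (i * p + j)) [0..<p]) [0..<q])
               (map (real_arr s ''lp_b'') [0..<q]) of
        Optimal y \<Rightarrow>
          setN ''lp_status'' 0 0
            (s\<lparr>real_arr := (real_arr s)
                  (''lp_y'' := (\<lambda>j. if j < p then y ! j else real_arr s ''lp_y'' j))\<rparr>)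
      | Infeasible \<Rightarrow> setN ''lp_status'' 0 1 s
      | Unbounded \<Rightarrow> setN ''lp_status'' 0 2 s)"

text \<open>
  Values of a set function come with the price of the evaluation, and are available for
  subsets of the ground set only.
\<close>

type_synonym value_oracle = "nat set \<Rightarrow> (real \<times> real) option"

text \<open>
  \<open>exec LP lps orc grp c s k m t\<close>: started in state \<open>s\<close>, the program \<open>c\<close> terminates in state
  \<open>t\<close> with effort \<open>k\<close>, during which the grouping algorithm is applied \<open>m\<close> times.
  Execution is deterministic, and there is none if \<open>c\<close> fails to terminate from \<open>s\<close>.
  A linear program with at most \<open>n\<close> variables and at most \<open>n\<close> constraints is charged \<open>LP n\<close>;
  \<open>grp e s k t\<close> is the effect of an application of the grouping algorithm.
\<close>

inductive exec ::
  "(nat \<Rightarrow> real) \<Rightarrow> lp_solver \<Rightarrow> value_oracle \<Rightarrow> (com \<Rightarrow> state \<Rightarrow> real \<Rightarrow> state \<Rightarrow> bool) \<Rightarrow>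
   com \<Rightarrow> state \<Rightarrow> real \<Rightarrow> nat \<Rightarrow> state \<Rightarrow> bool"
  for LP :: "nat \<Rightarrow> real" and lps :: lp_solver and orc :: value_oracle
  and grp :: "com \<Rightarrow> state \<Rightarrow> real \<Rightarrow> state \<Rightarrow> bool"
where
  Skip: "exec LP lps orc grp Skip s 0 0 s"
| NAsg: "exec LP lps orc grp (NAsg v i a) s (real (1 + nops i + nops a)) 0
           (setN v (nval s i) (nval s a) s)"
| SAsg: "exec LP lps orc grp (SAsg v i a) s (real (1 + nops i + sops a)) 0
           (setS v (nval s i) (sval s a) s)"
| RAsg: "exec LP lps orc grp (RAsg v i a) s (real (1 + nops i + rops a)) 0
           (setR v (nval s i) (rval s a) s)"
| Eval: "orc (sval s A) = Some (x, k) \<Longrightarrow>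
         exec LP lps orc grp (Eval v i A) s (real (nops i + sops A) + k) 0 (setR v (nval s i) x s)"
| SolveLP: "exec LP lps orc grp (SolveLP p q) s
              (real (nops p + nops q) + LP (max (nval s p) (nval s q))) 0
              (lp_call lps (nval s p) (nval s q) s)"
| Group: "grp e s k t \<Longrightarrow> exec LP lps orc grp (Group e) s (1 + k) 1 t"
| Seq: "exec LP lps orc grp c1 s k1 m1 t \<Longrightarrow> exec LP lps orc grp c2 t k2 m2 u \<Longrightarrow>
        exec LP lps orc grp (Seq c1 c2) s (k1 + k2) (m1 + m2) u"
| IfTrue: "bval s b \<Longrightarrow> exec LP lps orc grp c1 s k m t \<Longrightarrow>
           exec LP lps orc grp (Cond b c1 c2) s (real (bops b) + k) m t"
| IfFalse: "\<not> bval s b \<Longrightarrow> exec LP lps orc grp c2 s k m t \<Longrightarrow>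
            exec LP lps orc grp (Cond b c1 c2) s (real (bops b) + k) m t"
| WhileFalse: "\<not> bval s b \<Longrightarrow> exec LP lps orc grp (While b c) s (real (bops b)) 0 s"
| WhileTrue: "bval s b \<Longrightarrow> exec LP lps orc grp c s k1 m1 t \<Longrightarrow>
              exec LP lps orc grp (While b c) t k2 m2 u \<Longrightarrow>
              exec LP lps orc grp (While b c) s (real (bops b) + k1 + k2) (m1 + m2) u"

text \<open>No execution of a \<open>Group\<close> command is possible with the following argument for \<open>grp\<close>.\<close>

definition no_grp :: "com \<Rightarrow> state \<Rightarrow> real \<Rightarrow> state \<Rightarrow> bool" where
  "no_grp e s k t \<longleftrightarrow> False"


section \<open>The grouping algorithm\<close>

definition unit_oracle :: "nat \<Rightarrow> (nat set \<Rightarrow> real) \<Rightarrow> value_oracle" where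
  "unit_oracle n f = (\<lambda>A. if A \<subseteq> {..<n} then Some (f A, 1) else None)"

definition grouping_start :: "nat \<Rightarrow> (nat \<Rightarrow> nat) \<Rightarrow> (nat \<Rightarrow> real) \<Rightarrow> state" where
  "grouping_start n ord d = init_state
     \<lparr>nat_arr := (nat_arr init_state)(''n'' := (\<lambda>i. if i = 0 then n else 0),
                           ''ord'' := (\<lambda>i. if i < n then ord i else 0)),
      real_arr := (real_arr init_state)(''d'' := (\<lambda>i. if i < n then d i else 0))\<rparr>"

definition grouping_algorithm ::
  "(nat \<Rightarrow> real) \<Rightarrow> lp_solver \<Rightarrow> com \<Rightarrow> (nat \<Rightarrow> real) \<Rightarrow> bool" where
  "grouping_algorithm LP lps g T \<longleftrightarrow>
     (\<forall>n ord f d. grouping_input n ord f d \<longrightarrow>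
        (\<exists>k t. exec LP lps (unit_oracle n f) no_grp g (grouping_start n ord d) k 0 t \<and>
           grouping_output n ord f d
             (nat_arr t ''m'' 0) (nat_arr t ''lead'') (set_arr t ''G'') (real_arr t ''x'') \<and>
           k \<le> T n))"

text \<open>
  An application of the grouping algorithm \<open>g\<close> by another program.  The ground set size, the
  ordering and the vector are taken from the caller's \<open>n\<close>, \<open>ord\<close> and \<open>d\<close>.  Whenever \<open>g\<close>
  evaluates its set function \<open>f\<close> at a set, the program \<open>e\<close> is run on a copy of the caller's data
  with this set in entry 0 of the array named \<open>A\<close>; it can evaluate the caller's set function
  and leaves the value of \<open>f\<close> in entry 0 of \<open>val\<close>.  The evaluation of \<open>f\<close> is charged with the
  effort of this run.  The call has no execution unless its data satisfy the input conditions
  of the grouping problem.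
\<close>

definition group_call ::
  "(nat \<Rightarrow> real) \<Rightarrow> lp_solver \<Rightarrow> value_oracle \<Rightarrow> com \<Rightarrow> com \<Rightarrow> state \<Rightarrow> real \<Rightarrow> state \<Rightarrow> bool" where
  "group_call LP lps orc g e s k t \<longleftrightarrow>
     (let n = nat_arr s ''n'' 0; ord = nat_arr s ''ord''; d = real_arr s ''d'' in
      \<exists>f price u.
        (\<forall>A \<subseteq> {..<n}. \<exists>w. exec LP lps orc no_grp e (setS ''A'' 0 A s) (price A) 0 w \<and>
           f A = real_arr w ''val'' 0) \<and>
        grouping_input n ord f d \<and>
        exec LP lps (\<lambda>A. if A \<subseteq> {..<n} then Some (f A, 1 + price A) else None) no_grp
          g (grouping_start n ord d) k 0 u \<and>
        t = s\<lparr>nat_arr := (nat_arr s)(''m'' := nat_arr u ''m'', ''lead'' := nat_arr u ''lead''),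
              set_arr := (set_arr s)(''G'' := set_arr u ''G''),
              real_arr := (real_arr s)(''x'' := real_arr u ''x'')\<rparr>)"


section \<open>Minimization of a set function\<close>

text \<open>
  The elements of \<open>E\<close> are listed as \<open>el 0, \<dots>, el (n - 1)\<close>; programs access \<open>\<psi>\<close> only by
  evaluating it at sets of indices, for one unit operation each.  The input consists of \<open>n\<close>
  and the bound \<open>M\<close>.
\<close>

definition set_function_oracle :: "nat \<Rightarrow> (nat \<Rightarrow> 'a) \<Rightarrow> ('a set \<Rightarrow> real) \<Rightarrow> value_oracle" where
  "set_function_oracle n el \<psi> = unit_oracle n (\<lambda>I. \<psi> (el ` I))"

definition minimization_start :: "nat \<Rightarrow> real \<Rightarrow> state" where
  "minimization_start n M = setR ''M'' 0 M (setN ''n'' 0 n init_state)"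

end

theory Submission
  imports Defs
begin

text \<open>
  Let \<open>h\<close> be the set function to be minimized, on the indices \<open>{..<n}\<close>. The function
  \<open>f A = h A - h {} + c |A|\<close> is still submodular, and for a large slope \<open>c\<close> it is also
  increasing and nonnegative, so the grouping algorithm applies to it. Minimizing \<open>h\<close> means
  minimizing \<open>f A - c |A|\<close>, or equivalently \<open>f A + c |{..<n} - A|\<close>. The minimum of the latter
  is the maximum of \<open>d({..<n})\<close> over the vectors \<open>d\<close> with \<open>d(A) \<le> f A\<close> for all \<open>A\<close> and
  \<open>d i \<le> c\<close> for all \<open>i\<close>, and such a \<open>d\<close> is found greedily: starting from \<open>0\<close>, each coordinate
  in turn is raised as far as possible.

  One application of the grouping algorithm tells how far. If element \<open>k\<close> is listed first,
  it is the lead of the first group. The output \<open>x\<close> satisfies \<open>x(A) \<le> f A\<close> for all \<open>A\<close>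
  (\<open>grouping_output_le\<close>), dominates \<open>d\<close>, and is tight on the first group, which contains no
  other lead. Hence \<open>x k\<close> is the largest feasible value of coordinate \<open>k\<close>. Either it
  exceeds \<open>c\<close>, and \<open>d k\<close> becomes \<open>c\<close>, or \<open>d k\<close> becomes \<open>x k\<close> and the first group becomes a
  tight set. Unions of tight sets are tight, so after \<open>n\<close> applications there is a tight set
  \<open>D\<close> outside which \<open>d\<close> equals \<open>c\<close> (\<open>greedy_inv_step\<close>). Then
  \<open>f D + c |{..<n} - D| = d({..<n})\<close>, a lower bound for all sets, so that \<open>D\<close> minimizes \<open>h\<close>
  (\<open>greedy_inv_minimizes\<close>).

  For the effort it matters that \<open>f\<close> is evaluated by a program of constant effort, which is
  possible because the modular term of \<open>f\<close> depends on the cardinality alone. The effort of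
  each application therefore grows by a constant factor only (\<open>runs_Group\<close>).
\<close>

section \<open>The grouping problem and submodular minimization\<close>

lemma submodular_onD:
  "submodular_on V f \<Longrightarrow> A \<subseteq> V \<Longrightarrow> B \<subseteq> V \<Longrightarrow> f (A \<union> B) + f (A \<inter> B) \<le> f A + f B"
  by (simp add: submodular_on_def)

lemma grouping_outputD:
  assumes "grouping_output n ord f d m lead G x"
  shows groups_cover: "(\<Union>i<m. G i) = {..<n}"
    and groups_disjoint: "\<And>i j. i < m \<Longrightarrow> j < m \<Longrightarrow> i \<noteq> j \<Longrightarrow> G i \<inter> G j = {}"
    and lead_in_group: "\<And>i. i < m \<Longrightarrow> lead i \<in> G i"
    and nonlead_value: "\<And>k. k < n \<Longrightarrow> k \<notin> lead ` {..<m} \<Longrightarrow> x k = d k"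
    and lead_value: "\<And>i. i < m \<Longrightarrow>
      x (lead i) = f (\<Union>j<Suc i. G j) - f (\<Union>j<i. G j) - sum d (G i - {lead i})"
    and lead_ge: "\<And>i. i < m \<Longrightarrow> d (lead i) \<le> x (lead i)"
    and group_le: "\<And>i A. i < m \<Longrightarrow> A \<subseteq> G i \<Longrightarrow>
      sum x A \<le> f ((\<Union>j<i. G j) \<union> A) - f (\<Union>j<i. G j)"
    and leads_ordered: "\<And>i j. i < j \<Longrightarrow> j < m \<Longrightarrow> precedes n ord (lead i) (lead j)"
    and lead_first: "\<And>i k. i < m \<Longrightarrow> k \<in> G i \<Longrightarrow> k \<noteq> lead i \<Longrightarrow> precedes n ord (lead i) k"
proof -
  from assms[unfolded grouping_output_def]
  have cover: "(\<Union>i<m. G i) = {..<n}"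
    and disjoint: "\<forall>i<m. \<forall>j<m. i \<noteq> j \<longrightarrow> G i \<inter> G j = {}"
    and member: "\<forall>i<m. lead i \<in> G i"
    and nonlead: "\<forall>k<n. k \<notin> lead ` {..<m} \<longrightarrow> x k = d k"
    and lead: "\<forall>i<m. x (lead i) = f (\<Union>j<Suc i. G j) - f (\<Union>j<i. G j) - sum d (G i - {lead i})"
    and ge: "\<forall>i<m. x (lead i) \<ge> d (lead i)"
    and le: "\<forall>i<m. \<forall>A \<subseteq> G i. sum x A \<le> f ((\<Union>j<i. G j) \<union> A) - f (\<Union>j<i. G j)"
    and order: "\<forall>i<m. \<forall>j<m. i < j \<longrightarrow> precedes n ord (lead i) (lead j)"
    and first: "\<forall>i<m. \<forall>k \<in> G i - {lead i}. precedes n ord (lead i) k"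
    by - (elim conjE, assumption)+
  show "(\<Union>i<m. G i) = {..<n}"
    by (fact cover)
  show "G i \<inter> G j = {}" if "i < m" "j < m" "i \<noteq> j" for i j
    using disjoint that by simp
  show "lead i \<in> G i" if "i < m" for i
    using member that by simp
  show "x k = d k" if "k < n" "k \<notin> lead ` {..<m}" for k
    using nonlead that by simp
  show "x (lead i) = f (\<Union>j<Suc i. G j) - f (\<Union>j<i. G j) - sum d (G i - {lead i})"
    if "i < m" for i
    using lead that by blast
  show "d (lead i) \<le> x (lead i)" if "i < m" for i
    using ge that by simp
  show "sum x A \<le> f ((\<Union>j<i. G j) \<union> A) - f (\<Union>j<i. G j)" if "i < m" "A \<subseteq> G i" for i A
    using le that by simp
  show "precedes n ord (lead i) (lead j)" if "i < j" "j < m" for i j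
    using order that by simp
  show "precedes n ord (lead i) k" if "i < m" "k \<in> G i" "k \<noteq> lead i" for i k
    using first that by simp
qed

text \<open>
  Nothing precedes the first element of the ordering, so it can neither be a non-lead nor a
  later lead.
\<close>

lemma lead_zero_eq:
  assumes "grouping_input n ord f d" "grouping_output n ord f d m lead G x" "0 < n"
  shows "0 < m" "lead 0 = ord 0"
proof -
  have bij: "bij_betw ord {..<n} {..<n}"
    using assms(1) by (simp add: grouping_input_def)
  have first: "\<not> precedes n ord a (ord 0)" for a
    using inj_onD[OF bij_betw_imp_inj_on[OF bij], of _ 0] \<open>0 < n\<close>
    by (auto simp: precedes_def)
  have "ord 0 \<in> (\<Union>i<m. G i)"
    using bij_betwE[OF bij] assms(3) groups_cover[OF assms(2)] by simp
  then obtain i where i: "i < m" "ord 0 \<in> G i"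
    by blast
  have lead_i: "ord 0 = lead i"
    using lead_first[OF assms(2) i] first by blast
  have "i = 0"
  proof (rule ccontr)
    assume "i \<noteq> 0"
    then have "precedes n ord (lead 0) (lead i)"
      using leads_ordered[OF assms(2) _ i(1)] by simp
    with first lead_i show False
      by simp
  qed
  with i lead_i show "0 < m" "lead 0 = ord 0"
    by simp_all
qed

lemma grouping_output_ge:
  assumes "grouping_output n ord f d m lead G x" "k < n"
  shows "d k \<le> x k"
proof (cases "k \<in> lead ` {..<m}")
  case True
  then show ?thesis
    using lead_ge[OF assms(1)] by blast
next
  case False
  then show ?thesis
    using nonlead_value[OF assms] by simp
qed

text \<open>
  The bounds on \<open>x\<close> within the groups are relative to the preceding groups. Marginal values
  of a submodular function only grow when those groups are cut down to a given set \<open>A\<close>, so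
  the bounds on the pieces \<open>A \<inter> G i\<close> add up to the absolute bound at \<open>A\<close>.
\<close>

lemma grouping_output_le:
  assumes inp: "grouping_input n ord f d"
    and out: "grouping_output n ord f d m lead G x" and A: "A \<subseteq> {..<n}"
  shows "sum x A \<le> f A"
proof -
  define U where "U i = (\<Union>j<i. G j)" for i
  have U_m: "U m = {..<n}"
    using groups_cover[OF out] by (simp add: U_def)
  have U_le: "U i \<subseteq> {..<n}" if "i \<le> m" for i
  proof -
    have "U i \<subseteq> U m"
      using that unfolding U_def by (intro UN_mono) auto
    with U_m show ?thesis by simp
  qed
  have U_Suc: "U (Suc i) = U i \<union> G i" for i
    by (auto simp: U_def lessThan_Suc)
  have "sum x (A \<inter> U i) \<le> f (A \<inter> U i)" if "i \<le> m" for i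
    using that
  proof (induction i)
    case 0
    then show ?case
      using inp by (simp add: U_def grouping_input_def)
  next
    case (Suc i)
    have disj: "U i \<inter> G i = {}"
    proof -
      have "G j \<inter> G i = {}" if "j < i" for j
        using groups_disjoint[OF out, of j i] Suc.prems that by simp
      then show ?thesis
        unfolding U_def by blast
    qed
    have fin: "finite (A \<inter> S)" for S
      using A finite_subset by blast
    have "sum x (A \<inter> U (Suc i)) = sum x (A \<inter> U i) + sum x (A \<inter> G i)"
      unfolding U_Suc Int_Un_distrib using disj fin by (intro sum.union_disjoint) auto
    also have "\<dots> \<le> f (A \<inter> U i) + (f (U i \<union> A \<inter> G i) - f (U i))"
      using Suc group_le[OF out, of i "A \<inter> G i"] by (simp add: U_def)
    also have "\<dots> \<le> f (A \<inter> U (Suc i))"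
    proof -
      have "(A \<inter> U (Suc i)) \<union> U i = U i \<union> A \<inter> G i" "(A \<inter> U (Suc i)) \<inter> U i = A \<inter> U i"
        by (auto simp: U_Suc)
      moreover have "f ((A \<inter> U (Suc i)) \<union> U i) + f ((A \<inter> U (Suc i)) \<inter> U i)
          \<le> f (A \<inter> U (Suc i)) + f (U i)"
        using submodular_onD[of "{..<n}" f "A \<inter> U (Suc i)" "U i"] inp A U_le[of i] Suc.prems
        by (auto simp: grouping_input_def)
      ultimately show ?thesis by simp
    qed
    finally show ?case .
  qed
  from this[of m] A U_m show ?thesis
    by (simp add: Int_absorb2)
qed

lemma first_group_tight:
  assumes "grouping_output n ord f d m lead G x" "0 < m" "f {} = 0"
  shows "x (lead 0) + sum d (G 0 - {lead 0}) = f (G 0)"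
  using lead_value[OF assms(1,2)] assms(3) by (simp add: lessThan_Suc)

text \<open>
  The vector \<open>d\<close> and the set \<open>D\<close> after the coordinates below \<open>k\<close> have been raised: \<open>D\<close> is
  tight, so its coordinates cannot grow any more, and the raised coordinates outside \<open>D\<close> have
  reached the cap \<open>c\<close>.
\<close>

definition greedy_inv ::
  "nat \<Rightarrow> (nat set \<Rightarrow> real) \<Rightarrow> real \<Rightarrow> nat \<Rightarrow> (nat \<Rightarrow> real) \<Rightarrow> nat set \<Rightarrow> bool" where
  "greedy_inv n f c k d D \<longleftrightarrow>
     (\<forall>i<n. 0 \<le> d i \<and> d i \<le> c) \<and> (\<forall>A \<subseteq> {..<n}. sum d A \<le> f A) \<and>
     D \<subseteq> {..<n} \<and> sum d D = f D \<and> (\<forall>i<k. i \<notin> D \<longrightarrow> d i = c)"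

text \<open>
  The vector \<open>x\<close> lies below \<open>f\<close>, and so does everything below \<open>x\<close>. It exceeds \<open>d\<close> in
  coordinate \<open>k\<close> by as much as possible, since the first group, which contains \<open>k\<close>, is tight.
  So either \<open>k\<close> can be raised to the cap \<open>c\<close>, or it joins the tight set together with the
  first group. Tight sets stay tight when \<open>d\<close> grows, and are closed under union by
  submodularity.
\<close>

lemma greedy_inv_step:
  assumes inp: "grouping_input n ord f d"
    and out: "grouping_output n ord f d m lead G x"
    and k: "k < n" "ord 0 = k" and inv: "greedy_inv n f c k d D"
  shows "greedy_inv n f c (Suc k) (d(k := min (x k) c)) (if x k \<le> c then D \<union> G 0 else D)"
proof -
  define d' where "d' = d(k := min (x k) c)"
  define D' where "D' = (if x k \<le> c then D \<union> G 0 else D)"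
  have m: "0 < m" and lead: "lead 0 = k"
    using lead_zero_eq[OF inp out] k by auto
  have G0: "G 0 \<subseteq> {..<n}" "k \<in> G 0"
    using groups_cover[OF out] lead_in_group[OF out m] m lead by auto
  have D: "D \<subseteq> {..<n}" and D_tight: "sum d D = f D"
    using inv by (auto simp: greedy_inv_def)
  have fin: "finite A" if "A \<subseteq> {..<n}" for A
    using that finite_subset by blast
  have d'_ge: "d i \<le> d' i" if "i < n" for i
    using grouping_output_ge[OF out that] inv that by (auto simp: d'_def greedy_inv_def)
  have d'_le_x: "d' i \<le> x i" if "i < n" for i
    using grouping_output_ge[OF out that] by (auto simp: d'_def)
  have bound: "0 \<le> d' i \<and> d' i \<le> c" if "i < n" for i
    using d'_ge[OF that] inv that by (auto simp: d'_def greedy_inv_def)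
  have below: "sum d' A \<le> f A" if "A \<subseteq> {..<n}" for A
  proof -
    have "sum d' A \<le> sum x A"
      using d'_le_x that by (intro sum_mono) auto
    then show ?thesis
      using grouping_output_le[OF inp out that] by simp
  qed
  have "sum d D \<le> sum d' D"
    using d'_ge D by (intro sum_mono) auto
  with below[OF D] D_tight have D_tight': "sum d' D = f D"
    by simp
  have "D' \<subseteq> {..<n} \<and> sum d' D' = f D'"
  proof (cases "x k \<le> c")
    case True
    have "sum d' (G 0) = d' k + sum d' (G 0 - {k})"
      using G0 fin by (simp add: sum.remove)
    also have "sum d' (G 0 - {k}) = sum d (G 0 - {k})"
      by (rule sum.cong) (auto simp: d'_def)
    also have "d' k + sum d (G 0 - {k}) = f (G 0)"
      using first_group_tight[OF out m] inp True lead
      by (simp add: d'_def grouping_input_def)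
    finally have G_tight: "sum d' (G 0) = f (G 0)" .
    have "f (D \<union> G 0) + f (D \<inter> G 0) \<le> f D + f (G 0)"
      using inp D G0 by (intro submodular_onD) (simp_all add: grouping_input_def)
    also have "\<dots> = sum d' (D \<union> G 0) + sum d' (D \<inter> G 0)"
      using D_tight' G_tight fin[OF D] fin[OF G0(1)] by (simp add: sum.union_inter)
    finally have "sum d' (D \<union> G 0) = f (D \<union> G 0)"
      using below[of "D \<union> G 0"] below[of "D \<inter> G 0"] D G0 by fastforce
    with True D G0 show ?thesis
      by (simp add: D'_def)
  next
    case False
    then show ?thesis
      using D D_tight' by (simp add: D'_def)
  qed
  moreover have "d' i = c" if "i < Suc k" "i \<notin> D'" for i
    using that inv G0 by (auto simp: d'_def D'_def greedy_inv_def less_Suc_eq split: if_splits)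
  ultimately show ?thesis
    using bound below unfolding greedy_inv_def d'_def[symmetric] D'_def[symmetric] by blast
qed

text \<open>
  This is the easy half of the duality between \<open>d({..<n})\<close> and the least value of
  \<open>f A + c |{..<n} - A|\<close>: every \<open>d\<close> below \<open>f\<close> and \<open>c\<close> has \<open>d({..<n})\<close> as a lower bound for
  these values, and \<open>D\<close> attains it.
\<close>

lemma greedy_inv_minimizes:
  assumes inv: "greedy_inv n f c n d D" and A: "A \<subseteq> {..<n}"
  shows "f D - c * real (card D) \<le> f A - c * real (card A)"
proof -
  define gap where "gap S = (\<Sum>i\<in>S. d i - c)" for S
  have gap: "gap S = sum d S - c * real (card S)" for S
    by (simp add: gap_def sum_subtractf)
  have D: "D \<subseteq> {..<n}" "sum d D = f D"
    using inv by (auto simp: greedy_inv_def)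
  have d_le: "d i - c \<le> 0" if "i < n" for i
    using inv that by (simp add: greedy_inv_def)
  have "f D - c * real (card D) = gap D"
    using D(2) by (simp add: gap)
  also have "\<dots> = gap {..<n}"
    unfolding gap_def using inv D(1)
    by (intro sum.mono_neutral_left) (auto simp: greedy_inv_def)
  also have "\<dots> \<le> gap A"
  proof -
    have "gap ({..<n} - A) \<le> 0"
      unfolding gap_def using d_le by (intro sum_nonpos) auto
    moreover have "gap {..<n} = gap ({..<n} - A) + gap A"
      unfolding gap_def using A by (intro sum.subset_diff) auto
    ultimately show ?thesis
      by simp
  qed
  also have "\<dots> \<le> f A - c * real (card A)"
    using inv A by (simp add: gap greedy_inv_def)
  finally show ?thesis .
qed

definition tilt :: "(nat set \<Rightarrow> real) \<Rightarrow> real \<Rightarrow> nat set \<Rightarrow> real" where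
  "tilt h c A = h A - h {} + c * real (card A)"

lemma submodular_on_tilt:
  assumes "submodular_on V h" "finite V"
  shows "submodular_on V (tilt h c)"
  unfolding submodular_on_def
proof (intro allI impI)
  fix A B
  assume AB: "A \<subseteq> V" "B \<subseteq> V"
  then have "card A + card B = card (A \<union> B) + card (A \<inter> B)"
    using card_Un_Int assms(2) finite_subset by metis
  then have "c * real (card A) + c * real (card B)
      = c * real (card (A \<union> B)) + c * real (card (A \<inter> B))"
    by (metis distrib_left of_nat_add)
  with AB assms(1) show "tilt h c (A \<union> B) + tilt h c (A \<inter> B) \<le> tilt h c A + tilt h c B"
    by (simp add: tilt_def submodular_on_def algebra_simps)
qed

text \<open>
  By submodularity the marginal values of an element are least at the rest of the
  ground set, so only these need to be outweighed by the slope \<open>c\<close>.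
\<close>

lemma increasing_on_tilt:
  assumes sub: "submodular_on V h" and fin: "finite V"
    and slope: "\<And>i. i \<in> V \<Longrightarrow> h (V - {i}) - h V \<le> c"
  shows "increasing_on V (tilt h c)"
  unfolding increasing_on_def
proof (intro allI impI)
  fix A B
  assume AB: "A \<subseteq> B" "B \<subseteq> V"
  have "finite (B - A)"
    using AB fin finite_subset by blast
  moreover have "tilt h c A \<le> tilt h c (A \<union> S)" if "finite S" "S \<subseteq> B - A" for S
    using that
  proof (induction S)
    case empty
    then show ?case by simp
  next
    case (insert i S)
    let ?S = "A \<union> S"
    have i: "i \<in> V" "i \<notin> ?S" "?S \<subseteq> V" "finite ?S"
      using insert AB fin by (auto intro: finite_subset)
    have "h (insert i ?S \<union> (V - {i})) + h (insert i ?S \<inter> (V - {i}))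
        \<le> h (insert i ?S) + h (V - {i})"
      using i by (intro submodular_onD[OF sub]) auto
    moreover have "insert i ?S \<union> (V - {i}) = V" "insert i ?S \<inter> (V - {i}) = ?S"
      using i by auto
    ultimately have "h ?S \<le> h (insert i ?S) + c"
      using slope[OF i(1)] by simp
    then have "tilt h c ?S \<le> tilt h c (insert i ?S)"
      using i by (simp add: tilt_def algebra_simps)
    with insert show ?case by simp
  qed
  ultimately have "tilt h c A \<le> tilt h c (A \<union> (B - A))"
    by blast
  with AB show "tilt h c A \<le> tilt h c B"
    by (simp add: Un_absorb1)
qed

section \<open>Bounds on the effort of programs\<close>

text \<open>
  A total-correctness triple with an upper bound on the effort and the exact number of
  applications of the grouping algorithm. The rules below perform symbolic execution from left
  to right.
\<close>

definition runs ::
  "(nat \<Rightarrow> real) \<Rightarrow> lp_solver \<Rightarrow> value_oracle \<Rightarrow> (com \<Rightarrow> state \<Rightarrow> real \<Rightarrow> state \<Rightarrow> bool) \<Rightarrow>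
   com \<Rightarrow> state \<Rightarrow> real \<Rightarrow> nat \<Rightarrow> (state \<Rightarrow> bool) \<Rightarrow> bool" where
  "runs LP lps orc grp c s B m Q \<longleftrightarrow> (\<exists>k t. exec LP lps orc grp c s k m t \<and> k \<le> B \<and> Q t)"

lemma runs_weaken:
  "runs LP lps orc grp c s B m Q \<Longrightarrow> B \<le> B' \<Longrightarrow> m = m' \<Longrightarrow> runs LP lps orc grp c s B' m' Q"
  unfolding runs_def by fastforce

lemma runs_conseq:
  "runs LP lps orc grp c s B m Q \<Longrightarrow> (\<And>t. Q t \<Longrightarrow> Q' t) \<Longrightarrow> runs LP lps orc grp c s B m Q'"
  unfolding runs_def by blast

lemma runs_NAsg:
  "Q (setN v (nval s i) (nval s a) s) \<Longrightarrow>
   runs LP lps orc grp (NAsg v i a) s (real (1 + nops i + nops a)) 0 Q"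
  unfolding runs_def using exec.NAsg by blast

lemma runs_SAsg:
  "Q (setS v (nval s i) (sval s a) s) \<Longrightarrow>
   runs LP lps orc grp (SAsg v i a) s (real (1 + nops i + sops a)) 0 Q"
  unfolding runs_def using exec.SAsg by blast

lemma runs_RAsg:
  "Q (setR v (nval s i) (rval s a) s) \<Longrightarrow>
   runs LP lps orc grp (RAsg v i a) s (real (1 + nops i + rops a)) 0 Q"
  unfolding runs_def using exec.RAsg by blast

lemma runs_Eval:
  "Q (setR v (nval s i) (h (sval s A)) s) \<Longrightarrow> sval s A \<subseteq> {..<n} \<Longrightarrow>
   runs LP lps (unit_oracle n h) grp (Eval v i A) s (real (nops i + sops A) + 1) 0 Q"
  unfolding runs_def using exec.Eval[of "unit_oracle n h" s A]
  by (fastforce simp: unit_oracle_def)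

lemma runs_Seq:
  "runs LP lps orc grp c1 s B1 m1 (\<lambda>t. runs LP lps orc grp c2 t B2 m2 Q) \<Longrightarrow>
   runs LP lps orc grp (Seq c1 c2) s (B1 + B2) (m1 + m2) Q"
  unfolding runs_def by (meson add_mono exec.Seq)

lemma runs_CondTrue:
  "runs LP lps orc grp c1 s B m Q \<Longrightarrow> bval s b \<Longrightarrow>
   runs LP lps orc grp (Cond b c1 c2) s (real (bops b) + B) m Q"
  unfolding runs_def by (meson add_left_mono exec.IfTrue)

lemma runs_CondFalse:
  "runs LP lps orc grp c2 s B m Q \<Longrightarrow> \<not> bval s b \<Longrightarrow>
   runs LP lps orc grp (Cond b c1 c2) s (real (bops b) + B) m Q"
  unfolding runs_def by (meson add_left_mono exec.IfFalse)

lemma runs_While: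
  assumes body: "\<And>i s. i < n \<Longrightarrow> Inv i s \<Longrightarrow> runs LP lps orc grp c s B m (Inv (Suc i))"
    and guard: "\<And>i s. Inv i s \<Longrightarrow> bval s b \<longleftrightarrow> i < n"
    and init: "Inv 0 s"
  shows "runs LP lps orc grp (While b c) s (real n * (real (bops b) + B) + real (bops b)) (n * m) (Inv n)"
proof -
  have "runs LP lps orc grp (While b c) s (real j * (real (bops b) + B) + real (bops b)) (j * m) (Inv n)"
    if "j \<le> n" "Inv (n - j) s" for j s
    using that
  proof (induction j arbitrary: s)
    case 0
    then show ?case
      using guard[of n s] exec.WhileFalse unfolding runs_def by fastforce
  next
    case (Suc j)
    have "runs LP lps orc grp c s B m (Inv (Suc (n - Suc j)))"
      using Suc.prems by (intro body) auto
    then obtain k1 t where t: "exec LP lps orc grp c s k1 m t" "k1 \<le> B" "Inv (n - j) t"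
      using Suc.prems unfolding runs_def by (auto simp: Suc_diff_Suc)
    obtain k2 u where u: "exec LP lps orc grp (While b c) t k2 (j * m) u"
        "k2 \<le> real j * (real (bops b) + B) + real (bops b)" "Inv n u"
      using Suc.IH[of t] t Suc.prems unfolding runs_def by auto
    have "bval s b"
      using guard[OF Suc.prems(2)] Suc.prems(1) by simp
    from exec.WhileTrue[OF this t(1) u(1)]
    have "exec LP lps orc grp (While b c) s (real (bops b) + k1 + k2) (Suc j * m) u"
      by simp
    moreover have "real (bops b) + k1 + k2 \<le> real (Suc j) * (real (bops b) + B) + real (bops b)"
      using t(2) u(2) by (simp add: algebra_simps)
    ultimately show ?case
      using u(3) unfolding runs_def by blast
  qed
  from this[of n s] init show ?thesis
    by simp
qed


text \<open>
  Execution depends on the oracle only through the values it returns, so other prices leave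
  the run itself unchanged. The factor is at least 1 because it is applied to the
  effort of all other operations as well.
\<close>

lemma exec_change_prices:
  assumes "exec LP lps orc no_grp c s k m t" and LP: "\<forall>n. 0 \<le> LP n" and C: "1 \<le> C"
    and orc: "\<And>A x p. orc A = Some (x, p) \<Longrightarrow> \<exists>p'. orc' A = Some (x, p') \<and> p' \<le> C * p"
  shows "\<exists>k'. exec LP lps orc' no_grp c s k' m t \<and> k' \<le> C * k"
proof -
  have scale: "a \<le> C * a" if "0 \<le> a" for a
    using mult_right_mono[OF C that] by simp
  from assms(1) show ?thesis
  proof (induction rule: exec.induct)
    case (Skip s)
    then show ?case using exec.Skip by fastforce
  next
    case (NAsg v i a s)
    then show ?case using exec.NAsg scale[OF of_nat_0_le_iff] by blast
  next
    case (SAsg v i a s)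
    then show ?case using exec.SAsg scale[OF of_nat_0_le_iff] by blast
  next
    case (RAsg v i a s)
    then show ?case using exec.RAsg scale[OF of_nat_0_le_iff] by blast
  next
    case (Eval s A x p v i)
    then obtain p' where p': "orc' (sval s A) = Some (x, p')" "p' \<le> C * p"
      using orc by blast
    have "real (nops i + sops A) + p' \<le> C * (real (nops i + sops A) + p)"
      using p'(2) scale[of "real (nops i + sops A)"] by (simp add: distrib_left)
    moreover have "exec LP lps orc' no_grp (Eval v i A) s (real (nops i + sops A) + p') 0
        (setR v (nval s i) x s)"
      using p'(1) by (rule exec.Eval)
    ultimately show ?case
      by blast
  next
    case (SolveLP p q s)
    have "0 \<le> real (nops p + nops q) + LP (max (nval s p) (nval s q))"
      using LP by (simp add: add_nonneg_nonneg)
    then show ?case using exec.SolveLP scale by blast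
  next
    case (Group e s k t)
    then show ?case by (simp add: no_grp_def)
  next
    case (Seq c1 s k1 m1 t c2 k2 m2 u)
    then obtain k1' k2' where
      "exec LP lps orc' no_grp c1 s k1' m1 t" "k1' \<le> C * k1"
      "exec LP lps orc' no_grp c2 t k2' m2 u" "k2' \<le> C * k2"
      by blast
    then show ?case
      by (intro exI[of _ "k1' + k2'"]) (auto intro: exec.Seq simp: distrib_left)
  next
    case (IfTrue s b c1 k m t c2)
    then obtain k' where "exec LP lps orc' no_grp c1 s k' m t" "k' \<le> C * k"
      by blast
    then show ?case
      using scale[of "real (bops b)"] IfTrue.hyps(1)
      by (intro exI[of _ "real (bops b) + k'"]) (auto intro: exec.IfTrue simp: distrib_left)
  next
    case (IfFalse s b c2 k m t c1)
    then obtain k' where "exec LP lps orc' no_grp c2 s k' m t" "k' \<le> C * k"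
      by blast
    then show ?case
      using scale[of "real (bops b)"] IfFalse.hyps(1)
      by (intro exI[of _ "real (bops b) + k'"]) (auto intro: exec.IfFalse simp: distrib_left)
  next
    case (WhileFalse s b c)
    then show ?case using exec.WhileFalse scale[OF of_nat_0_le_iff] by blast
  next
    case (WhileTrue s b c k1 m1 t k2 m2 u)
    then obtain k1' k2' where ex:
      "exec LP lps orc' no_grp c s k1' m1 t" "exec LP lps orc' no_grp (While b c) t k2' m2 u"
      and le: "k1' \<le> C * k1" "k2' \<le> C * k2"
      by blast
    have "real (bops b) + k1' + k2' \<le> C * (real (bops b) + k1 + k2)"
      using scale[of "real (bops b)"] le by (simp add: distrib_left)
    with exec.WhileTrue[OF WhileTrue.hyps(1) ex] show ?case
      by blast
  qed
qed

text \<open>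
  The effort of the grouping algorithm is bounded for evaluations at unit price only.
  If instead an evaluation runs a program of bounded effort \<open>P\<close>, every step becomes
  more expensive by a factor of at most \<open>1 + P\<close>.
\<close>

lemma runs_Group:
  fixes s :: state
  defines "n \<equiv> nat_arr s ''n'' 0" and "ord \<equiv> nat_arr s ''ord''" and "d \<equiv> real_arr s ''d''"
  assumes alg: "grouping_algorithm LP lps g Tg" and LP: "\<forall>n. 0 \<le> LP n" and P: "0 \<le> P"
    and inp: "grouping_input n ord f d"
    and e: "\<And>A. A \<subseteq> {..<n} \<Longrightarrow>
      runs LP lps orc no_grp e (setS ''A'' 0 A s) P 0 (\<lambda>w. f A = real_arr w ''val'' 0)"
  shows "runs LP lps orc (group_call LP lps orc g) (Group e) s (1 + (1 + P) * Tg n) 1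
    (\<lambda>t. \<exists>m lead G x. grouping_output n ord f d (m 0) lead G x \<and>
       t = s\<lparr>nat_arr := (nat_arr s)(''m'' := m, ''lead'' := lead),
             set_arr := (set_arr s)(''G'' := G), real_arr := (real_arr s)(''x'' := x)\<rparr>)"
proof -
  have "\<forall>A. \<exists>p. A \<subseteq> {..<n} \<longrightarrow> p \<le> P \<and>
      (\<exists>w. exec LP lps orc no_grp e (setS ''A'' 0 A s) p 0 w \<and> f A = real_arr w ''val'' 0)"
    using e unfolding runs_def by blast
  then obtain price where price: "\<And>A. A \<subseteq> {..<n} \<Longrightarrow> price A \<le> P \<and>
      (\<exists>w. exec LP lps orc no_grp e (setS ''A'' 0 A s) (price A) 0 w \<and> f A = real_arr w ''val'' 0)"
    by metis
  obtain k u where u: "exec LP lps (unit_oracle n f) no_grp g (grouping_start n ord d) k 0 u"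
      "grouping_output n ord f d (nat_arr u ''m'' 0) (nat_arr u ''lead'') (set_arr u ''G'')
         (real_arr u ''x'')" "k \<le> Tg n"
    using alg inp unfolding grouping_algorithm_def by blast
  let ?orc = "\<lambda>A. if A \<subseteq> {..<n} then Some (f A, 1 + price A) else None"
  have "\<exists>p'. ?orc A = Some (x, p') \<and> p' \<le> (1 + P) * p" if "unit_oracle n f A = Some (x, p)" for A x p
    using that price[of A] by (auto simp: unit_oracle_def split: if_splits)
  then obtain k' where k': "exec LP lps ?orc no_grp g (grouping_start n ord d) k' 0 u"
      "k' \<le> (1 + P) * k"
    using exec_change_prices[OF u(1) LP, of "1 + P" ?orc] P by auto
  define t where "t = s\<lparr>nat_arr := (nat_arr s)(''m'' := nat_arr u ''m'', ''lead'' := nat_arr u ''lead''),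
             set_arr := (set_arr s)(''G'' := set_arr u ''G''),
             real_arr := (real_arr s)(''x'' := real_arr u ''x'')\<rparr>"
  have "group_call LP lps orc g e s k' t"
    unfolding group_call_def Let_def t_def n_def[symmetric] ord_def[symmetric] d_def[symmetric]
    using price k'(1) inp by (intro exI[of _ f] exI[of _ price] exI[of _ u]) simp
  then have "exec LP lps orc (group_call LP lps orc g) (Group e) s (1 + k') 1 t"
    by (rule exec.Group)
  moreover have "(1 + P) * k \<le> (1 + P) * Tg n"
    using u(3) P by (intro mult_left_mono) auto
  ultimately show ?thesis
    unfolding runs_def using k'(2) u(2)
    by (intro exI[of _ "1 + k'"] exI[of _ t] conjI) (assumption, linarith, auto simp: t_def)
qed

section \<open>The minimization program\<close>

abbreviation nvar :: "vname \<Rightarrow> nexp" where "nvar v \<equiv> NVar v (NNum 0)"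
abbreviation svar :: "vname \<Rightarrow> sexp" where "svar v \<equiv> SVar v (NNum 0)"
abbreviation rvar :: "vname \<Rightarrow> rexp" where "rvar v \<equiv> RVar v (NNum 0)"

abbreviation below_n :: bexp where
  "below_n \<equiv> BNot (BLeN (nvar ''n'') (nvar ''i''))"

abbreviation next_i :: com where
  "next_i \<equiv> NAsg ''i'' (NNum 0) (NAdd (nvar ''i'') (NNum 1))"

definition list_body :: com where
  "list_body =
     Seq (SAsg ''ground'' (NNum 0) (SInsert (nvar ''i'') (svar ''ground'')))
    (Seq (NAsg ''ord'' (nvar ''i'') (nvar ''i'')) next_i)"

text \<open>
  The slope must be at least \<open>h ({..<n} - {i}) - h {..<n}\<close> for every \<open>i\<close>. As \<open>-M\<close> is a lower bound of
  \<open>h\<close>, this difference is at most \<open>h ({..<n} - {i}) + M\<close>, which is nonnegative, so the sum over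
  all \<open>i\<close> serves for each of them.
\<close>

definition slope_body :: com where
  "slope_body =
     Seq (Eval ''tmp'' (NNum 0) (SDiff (svar ''ground'') (SInsert (nvar ''i'') SEmpty)))
    (Seq (RAsg ''slope'' (NNum 0) (RAdd (rvar ''slope'') (RAdd (rvar ''tmp'') (rvar ''M'')))) next_i)"

definition eval_tilt :: com where
  "eval_tilt =
     Seq (Eval ''val'' (NNum 0) (svar ''A''))
         (RAsg ''val'' (NNum 0) (RAdd (RSub (rvar ''val'') (rvar ''psi0''))
            (RMul (rvar ''slope'') (RNat (NCard (svar ''A''))))))"

definition update_com :: com where
  "update_com =
     Cond (BLeR (RVar ''x'' (nvar ''i'')) (rvar ''slope''))
       (Seq (RAsg ''d'' (nvar ''i'') (RVar ''x'' (nvar ''i'')))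
            (SAsg ''result'' (NNum 0) (SUnion (svar ''result'') (svar ''G''))))
       (RAsg ''d'' (nvar ''i'') (rvar ''slope''))"

text \<open>
  The listing is the numerical order with 0 and \<open>i\<close> exchanged, which puts \<open>i\<close> first. Afterwards
  only entry \<open>i\<close> is restored, since the next round overwrites entry 0. For \<open>i = 0\<close>
  the two assignments before the application have no effect beyond setting entry 0 to 0.
\<close>

definition greedy_body :: com where
  "greedy_body =
     Seq (NAsg ''ord'' (NNum 0) (nvar ''i''))
    (Seq (NAsg ''ord'' (nvar ''i'') (NNum 0))
    (Seq (Group eval_tilt)
    (Seq update_com
    (Seq (NAsg ''ord'' (nvar ''i'') (nvar ''i'')) next_i))))"

definition minimize :: com where
  "minimize =
     Seq (While below_n list_body)
    (Seq (Eval ''psi0'' (NNum 0) SEmpty)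
    (Seq (NAsg ''i'' (NNum 0) (NNum 0))
    (Seq (While below_n slope_body)
    (Seq (NAsg ''i'' (NNum 0) (NNum 0))
         (While below_n greedy_body)))))"

lemma state_simps [simp]:
  "nat_arr (setN v i a s) = (nat_arr s)(v := (nat_arr s v)(i := a))"
  "set_arr (setN v i a s) = set_arr s"
  "real_arr (setN v i a s) = real_arr s"
  "nat_arr (setS v i A s) = nat_arr s"
  "set_arr (setS v i A s) = (set_arr s)(v := (set_arr s v)(i := A))"
  "real_arr (setS v i A s) = real_arr s"
  "nat_arr (setR v i x s) = nat_arr s"
  "set_arr (setR v i x s) = set_arr s"
  "real_arr (setR v i x s) = (real_arr s)(v := (real_arr s v)(i := x))"
  by (simp_all add: setN_def setS_def setR_def)

definition list_inv :: "nat \<Rightarrow> real \<Rightarrow> nat \<Rightarrow> state \<Rightarrow> bool" where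
  "list_inv n M i s \<longleftrightarrow>
     nat_arr s ''n'' 0 = n \<and> nat_arr s ''i'' 0 = i \<and> i \<le> n \<and> (\<forall>j<i. nat_arr s ''ord'' j = j) \<and>
     set_arr s ''ground'' 0 = {..<i} \<and> set_arr s ''result'' 0 = {} \<and>
     real_arr s ''M'' 0 = M \<and> real_arr s ''slope'' 0 = 0 \<and> real_arr s ''d'' = (\<lambda>_. 0)"

lemma runs_list_body:
  assumes "i < n" "list_inv n M i s"
  shows "runs LP lps orc grp list_body s 18 0 (list_inv n M (Suc i))"
  unfolding list_body_def
  apply (rule runs_weaken, (rule runs_Seq runs_NAsg runs_SAsg)+)
  using assms by (auto simp: list_inv_def less_Suc_eq)

definition slope_inv :: "nat \<Rightarrow> (nat set \<Rightarrow> real) \<Rightarrow> real \<Rightarrow> nat \<Rightarrow> state \<Rightarrow> bool" where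
  "slope_inv n h M i s \<longleftrightarrow>
     nat_arr s ''n'' 0 = n \<and> nat_arr s ''i'' 0 = i \<and> i \<le> n \<and> (\<forall>j<n. nat_arr s ''ord'' j = j) \<and>
     set_arr s ''ground'' 0 = {..<n} \<and> set_arr s ''result'' 0 = {} \<and>
     real_arr s ''M'' 0 = M \<and> real_arr s ''psi0'' 0 = h {} \<and>
     real_arr s ''slope'' 0 = (\<Sum>j<i. h ({..<n} - {j}) + M) \<and> real_arr s ''d'' = (\<lambda>_. 0)"

lemma runs_slope_body:
  assumes "i < n" "slope_inv n h M i s"
  shows "runs LP lps (unit_oracle n h) grp slope_body s 25 0 (slope_inv n h M (Suc i))"
  unfolding slope_body_def
  apply (rule runs_weaken, (rule runs_Seq runs_NAsg runs_RAsg runs_Eval)+)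
  using assms by (auto simp: slope_inv_def)

lemma runs_eval_tilt:
  assumes "A \<subseteq> {..<n}" "real_arr s ''psi0'' 0 = h {}" "real_arr s ''slope'' 0 = c"
  shows "runs LP lps (unit_oracle n h) grp eval_tilt (setS ''A'' 0 A s) 19 0
           (\<lambda>w. tilt h c A = real_arr w ''val'' 0)"
  unfolding eval_tilt_def
  apply (rule runs_weaken, (rule runs_Seq runs_RAsg runs_Eval)+)
  using assms by (auto simp: tilt_def)

definition greedy_state :: "nat \<Rightarrow> (nat set \<Rightarrow> real) \<Rightarrow> real \<Rightarrow> nat \<Rightarrow> state \<Rightarrow> bool" where
  "greedy_state n h c i s \<longleftrightarrow>
     nat_arr s ''n'' 0 = n \<and> nat_arr s ''i'' 0 = i \<and> i \<le> n \<and>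
     (\<forall>j<n. 0 < j \<longrightarrow> nat_arr s ''ord'' j = j) \<and>
     real_arr s ''psi0'' 0 = h {} \<and> real_arr s ''slope'' 0 = c \<and>
     greedy_inv n (tilt h c) c i (real_arr s ''d'') (set_arr s ''result'' 0)"

lemma bij_betw_swap_first:
  fixes k n :: nat
  assumes "k < n" "\<And>j. j < n \<Longrightarrow> ord j = (if j = 0 then k else if j = k then 0 else j)"
  shows "bij_betw ord {..<n} {..<n}"
proof -
  have "ord j < n \<and> ord (ord j) = j" if "j < n" for j
  proof -
    have "0 < n"
      using assms(1) by linarith
    then show ?thesis
      using assms(1) assms(2)[of 0] assms(2)[of k] assms(2)[OF that] that by auto
  qed
  then show ?thesis
    by (intro bij_betw_byWitness[where f' = ord]) auto
qed

lemma runs_greedy_body: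
  assumes alg: "grouping_algorithm LP lps g Tg" and LP: "\<forall>n. 0 \<le> LP n"
    and sub: "submodular_on {..<n} h"
    and slope: "\<And>i. i < n \<Longrightarrow> h ({..<n} - {i}) - h {..<n} \<le> c"
    and i: "i < n" and st: "greedy_state n h c i s"
  shows "runs LP lps (unit_oracle n h) (group_call LP lps (unit_oracle n h) g) greedy_body s
           (39 + 20 * Tg n) 1 (greedy_state n h c (Suc i))"
proof -
  let ?f = "tilt h c"
  define s' where "s' = setN ''ord'' i 0 (setN ''ord'' 0 i s)"
  define d where "d = real_arr s ''d''"
  define D where "D = set_arr s ''result'' 0"
  have inv: "greedy_inv n ?f c i d D"
    using st by (simp add: greedy_state_def d_def D_def)
  have arrs: "nat_arr s' ''n'' 0 = n" "nat_arr s' ''i'' 0 = i" "real_arr s' ''d'' = d"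
      "set_arr s' ''result'' 0 = D" "real_arr s' ''psi0'' 0 = h {}" "real_arr s' ''slope'' 0 = c"
    using st by (simp_all add: s'_def greedy_state_def d_def D_def)
  have ord: "nat_arr s' ''ord'' j = (if j = 0 then i else if j = i then 0 else j)" if "j < n" for j
    using st that by (auto simp: s'_def greedy_state_def)
  have incr: "increasing_on {..<n} ?f"
    using sub slope by (intro increasing_on_tilt) auto
  have "?f {} = 0"
    by (simp add: tilt_def)
  with incr have "\<forall>A \<subseteq> {..<n}. 0 \<le> ?f A"
    unfolding increasing_on_def by (metis empty_subsetI)
  then have inp: "grouping_input n (nat_arr s' ''ord'') ?f d"
    using incr sub inv i ord bij_betw_swap_first[of i n "nat_arr s' ''ord''"]
    by (simp add: grouping_input_def submodular_on_tilt greedy_inv_def \<open>?f {} = 0\<close>)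
  have group: "runs LP lps (unit_oracle n h) (group_call LP lps (unit_oracle n h) g)
      (Group eval_tilt) s' (1 + (1 + 19) * Tg n) 1
      (\<lambda>t. \<exists>m lead G x. grouping_output n (nat_arr s' ''ord'') ?f d (m 0) lead G x \<and>
         t = s'\<lparr>nat_arr := (nat_arr s')(''m'' := m, ''lead'' := lead),
             set_arr := (set_arr s')(''G'' := G), real_arr := (real_arr s')(''x'' := x)\<rparr>)"
    using runs_Group[OF alg LP, of 19 s' ?f "unit_oracle n h" eval_tilt] inp
      runs_eval_tilt[of _ n s' h c LP lps no_grp] unfolding arrs by simp
  let ?rest = "Seq update_com (Seq (NAsg ''ord'' (nvar ''i'') (nvar ''i'')) next_i)"
  have rest: "runs LP lps (unit_oracle n h) (group_call LP lps (unit_oracle n h) g)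
      ?rest t 30 0 (greedy_state n h c (Suc i))"
    if out: "grouping_output n (nat_arr s' ''ord'') ?f d (m 0) lead G x"
      and t: "t = s'\<lparr>nat_arr := (nat_arr s')(''m'' := m, ''lead'' := lead),
             set_arr := (set_arr s')(''G'' := G), real_arr := (real_arr s')(''x'' := x)\<rparr>"
    for t m lead G x
  proof -
    have step: "greedy_inv n ?f c (Suc i) (d(i := min (x i) c)) (if x i \<le> c then D \<union> G 0 else D)"
      using inv i ord[of 0] by (intro greedy_inv_step[OF inp out]) auto
    show ?thesis
    proof (cases "x i \<le> c")
      case True
      show ?thesis
        unfolding update_com_def
        apply (rule runs_weaken, (rule runs_Seq runs_CondTrue runs_NAsg runs_RAsg runs_SAsg)+)
        using step i by (simp_all add: greedy_state_def t arrs ord True)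
    next
      case False
      then have "min (x i) c = c"
        by (simp add: min_def)
      then have capped: "greedy_inv n ?f c (Suc i) (d(i := c)) D"
        using step by (simp only: False if_False)
      show ?thesis
        unfolding update_com_def
        apply (rule runs_weaken, (rule runs_Seq runs_CondFalse runs_NAsg runs_RAsg)+)
        using capped i by (simp_all add: greedy_state_def t arrs ord False)
    qed
  qed
  have "runs LP lps (unit_oracle n h) (group_call LP lps (unit_oracle n h) g)
      (Seq (Group eval_tilt) ?rest) s' (1 + (1 + 19) * Tg n + 30) (1 + 0) (greedy_state n h c (Suc i))"
    by (intro runs_Seq runs_conseq[OF group]) (blast intro: rest)
  moreover have "nat_arr s ''i'' 0 = i"
    using st by (simp add: greedy_state_def)
  ultimately show ?thesis
    unfolding greedy_body_def
    by (intro runs_weaken[OF runs_Seq[OF runs_NAsg[OF runs_Seq[OF runs_NAsg]]]]) (auto simp: s'_def)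
qed

text \<open>
  The three loops spend 24, 31 and 45 operations on each element besides the applications of
  the grouping algorithm, which become dearer by the factor \<open>20 = 1 + 19\<close>, where 19 is the effort
  of \<open>eval_tilt\<close>.
\<close>

lemma runs_minimize:
  assumes alg: "grouping_algorithm LP lps g Tg" and LP: "\<forall>n. 0 \<le> LP n"
    and sub: "submodular_on {..<n} h" and M: "\<And>A. A \<subseteq> {..<n} \<Longrightarrow> - M \<le> h A"
  shows "runs LP lps (unit_oracle n h) (group_call LP lps (unit_oracle n h) g) minimize
           (minimization_start n M) (27 + real n * (100 + 20 * Tg n)) n
           (\<lambda>t. set_arr t ''result'' 0 \<subseteq> {..<n} \<and>
             (\<forall>A \<subseteq> {..<n}. h (set_arr t ''result'' 0) \<le> h A))"
proof -
  define c where "c = (\<Sum>j<n. h ({..<n} - {j}) + M)"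
  have summand: "0 \<le> h ({..<n} - {j}) + M" for j
    using M[of "{..<n} - {j}"] by auto
  have slope: "h ({..<n} - {i}) - h {..<n} \<le> c" if "i < n" for i
  proof -
    have "h ({..<n} - {i}) + M \<le> c"
      unfolding c_def using that summand by (intro member_le_sum) auto
    then show ?thesis
      using M[of "{..<n}"] by simp
  qed
  have "0 \<le> c"
    unfolding c_def using summand by (intro sum_nonneg)
  let ?runs = "runs LP lps (unit_oracle n h) (group_call LP lps (unit_oracle n h) g)"
  let ?post = "\<lambda>t. set_arr t ''result'' 0 \<subseteq> {..<n} \<and>
             (\<forall>A \<subseteq> {..<n}. h (set_arr t ''result'' 0) \<le> h A)"
  have loop1: "?runs (While below_n list_body) (minimization_start n M) (real n * (6 + 18) + 6) 0
      (list_inv n M n)"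
    by (rule runs_weaken, rule runs_While[where Inv = "list_inv n M" and n = n, OF runs_list_body])
      (auto simp: list_inv_def minimization_start_def init_state_def)
  have loop2: "?runs (While below_n slope_body) s (real n * (6 + 25) + 6) 0 (slope_inv n h M n)"
    if "slope_inv n h M 0 s" for s
    by (rule runs_weaken, rule runs_While[where Inv = "slope_inv n h M" and n = n, OF runs_slope_body])
      (use that in \<open>auto simp: slope_inv_def\<close>)
  have loop3: "?runs (While below_n greedy_body) s (real n * (6 + (39 + 20 * Tg n)) + 6) n ?post"
    if "greedy_state n h c 0 s" for s
  proof (rule runs_conseq)
    show "?runs (While below_n greedy_body) s (real n * (6 + (39 + 20 * Tg n)) + 6) n
        (greedy_state n h c n)"
      by (rule runs_weaken, rule runs_While[where Inv = "greedy_state n h c" and n = n,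
            OF runs_greedy_body[OF alg LP sub slope]])
        (use that in \<open>auto simp: greedy_state_def\<close>)
  next
    fix t
    assume "greedy_state n h c n t"
    then have inv: "greedy_inv n (tilt h c) c n (real_arr t ''d'') (set_arr t ''result'' 0)"
      by (simp add: greedy_state_def)
    then have "set_arr t ''result'' 0 \<subseteq> {..<n}"
      by (simp add: greedy_inv_def)
    then show "?post t"
      using greedy_inv_minimizes[OF inv] by (simp add: tilt_def)
  qed
  have after1: "slope_inv n h M 0 (setN ''i'' 0 0 (setR ''psi0'' 0 (h {}) s))"
    if "list_inv n M n s" for s
    using that by (auto simp: list_inv_def slope_inv_def)
  have after2: "greedy_state n h c 0 (setN ''i'' 0 0 s)" if "slope_inv n h M n s" for s
  proof -
    have "increasing_on {..<n} (tilt h c)"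
      using sub slope by (intro increasing_on_tilt) auto
    then have "tilt h c {} \<le> tilt h c A" if "A \<subseteq> {..<n}" for A
      using that unfolding increasing_on_def by blast
    then have "greedy_inv n (tilt h c) c 0 (\<lambda>_. 0) {}"
      using \<open>0 \<le> c\<close> by (simp add: greedy_inv_def tilt_def)
    then show ?thesis
      using that by (simp add: greedy_state_def slope_inv_def c_def)
  qed
  let ?B3 = "real n * (6 + (39 + 20 * Tg n)) + 6"
  let ?reset = "NAsg ''i'' (NNum 0) (NNum 0)"
  have tail3: "?runs (Seq ?reset (While below_n greedy_body)) s (3 + ?B3) (0 + n) ?post"
    if "slope_inv n h M n s" for s
    using loop3[OF after2[OF that]] by (intro runs_Seq runs_weaken[OF runs_NAsg]) auto
  have tail2: "?runs (Seq (While below_n slope_body) (Seq ?reset (While below_n greedy_body))) s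
      (real n * (6 + 25) + 6 + (3 + ?B3)) (0 + (0 + n)) ?post" if "slope_inv n h M 0 s" for s
    by (rule runs_Seq, rule runs_conseq[OF loop2[OF that]], rule tail3)
  have tail1: "?runs (Seq (Eval ''psi0'' (NNum 0) SEmpty) (Seq ?reset
      (Seq (While below_n slope_body) (Seq ?reset (While below_n greedy_body))))) s
      (3 + (3 + (real n * (6 + 25) + 6 + (3 + ?B3)))) (0 + (0 + (0 + (0 + n)))) ?post"
    if "list_inv n M n s" for s
    by (rule runs_Seq, rule runs_weaken[OF runs_Eval], rule runs_Seq, rule runs_weaken[OF runs_NAsg])
      (use tail2[OF after1[OF that]] in auto)
  have "?runs minimize (minimization_start n M)
      (real n * (6 + 18) + 6 + (3 + (3 + (real n * (6 + 25) + 6 + (3 + ?B3)))))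
      (0 + (0 + (0 + (0 + (0 + n))))) ?post"
    unfolding minimize_def by (rule runs_Seq, rule runs_conseq[OF loop1], rule tail1)
  then show ?thesis
    by (rule runs_weaken) (simp_all add: algebra_simps)
qed

theorem mainTheorem3:
  fixes LP :: "nat \<Rightarrow> real" and lps :: lp_solver and g :: com and Tg :: "nat \<Rightarrow> real"
  assumes "correct_lp_solver lps"
    and "mono LP" and "\<forall>n. 1 \<le> LP n"
    and "grouping_algorithm LP lps g Tg"
    and "Tg \<in> O(\<lambda>n. real n ^ 3 * LP n)"
  shows "\<exists>alg :: com. \<exists>T \<in> O(\<lambda>n. real n ^ 4 * LP n).
    \<forall>(E :: 'a set) (\<psi> :: 'a set \<Rightarrow> real) (M :: real) (n :: nat) (el :: nat \<Rightarrow> 'a).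
      finite E \<longrightarrow> card E = n \<longrightarrow> bij_betw el {..<n} E \<longrightarrow>
      submodular_on E \<psi> \<longrightarrow> M > 0 \<longrightarrow> (\<forall>A \<subseteq> E. \<psi> A \<ge> - M) \<longrightarrow>
      (\<exists>k t A.
         exec LP lps (set_function_oracle n el \<psi>)
           (group_call LP lps (set_function_oracle n el \<psi>) g)
           alg (minimization_start n M) k n t \<and>
         k \<le> T n \<and>
         A = el ` set_arr t ''result'' 0 \<and> A \<subseteq> E \<and> \<psi> A = Min (\<psi> ` Pow E))"
proof -
  have LP: "\<forall>n. 0 \<le> LP n"
    using assms(3) by (meson order_trans zero_le_one)
  define T where "T n = 27 + real n * (100 + 20 * Tg n)" for n
  let ?bound = "\<lambda>n. real n ^ 4 * LP n"
  have poly: "(\<lambda>n. real n ^ j) \<in> O(?bound)" if "j \<le> 4" for j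
  proof (rule landau_o.big_mono, rule eventually_sequentiallyI[of 1])
    fix n :: nat
    assume "1 \<le> n"
    then have "real n ^ j * 1 \<le> real n ^ 4 * LP n"
      using that assms(3) by (intro mult_mono power_increasing) auto
    with LP show "norm (real n ^ j) \<le> norm (?bound n)"
      by simp
  qed
  \<comment> \<open>The lower-order terms of \<open>T\<close> are absorbed because \<open>LP\<close> is bounded below by 1.\<close>
  have "(\<lambda>n. real n * Tg n) \<in> O(\<lambda>n. real n * (real n ^ 3 * LP n))"
    using assms(5) by (intro landau_o.big.mult) auto
  then have "(\<lambda>n. real n * Tg n) \<in> O(?bound)"
    by (simp add: power_numeral_reduce algebra_simps)
  then have "(\<lambda>n. 27 * real n ^ 0 + 100 * real n ^ 1 + 20 * (real n * Tg n)) \<in> O(?bound)"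
    using poly[of 0] poly[of 1] by (intro sum_in_bigo landau_o.big.cmult_in_iff[THEN iffD2]) auto
  then have T: "T \<in> O(?bound)"
    unfolding T_def by (simp add: algebra_simps)
  show ?thesis
  proof (intro exI[of _ minimize] bexI[OF _ T] allI impI)
    fix E :: "'a set" and \<psi> :: "'a set \<Rightarrow> real" and M :: real and n :: nat and el :: "nat \<Rightarrow> 'a"
    assume E: "finite E" "bij_betw el {..<n} E" and sub: "submodular_on E \<psi>"
      and M: "\<forall>A \<subseteq> E. \<psi> A \<ge> - M"
    define h where "h I = \<psi> (el ` I)" for I
    have image: "el ` I \<subseteq> E" if "I \<subseteq> {..<n}" for I
      using E(2) that by (auto simp: bij_betw_def)
    have "submodular_on {..<n} h"
      unfolding submodular_on_def
    proof (intro allI impI)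
      fix A B
      assume AB: "A \<subseteq> {..<n}" "B \<subseteq> {..<n}"
      have "el ` (A \<inter> B) = el ` A \<inter> el ` B"
        using E(2) AB inj_on_image_Int by (metis bij_betw_imp_inj_on)
      then show "h A + h B \<ge> h (A \<union> B) + h (A \<inter> B)"
        using sub image AB by (simp add: submodular_on_def h_def image_Un)
    qed
    moreover have "- M \<le> h A" if "A \<subseteq> {..<n}" for A
      using M image[OF that] by (simp add: h_def)
    ultimately have "runs LP lps (unit_oracle n h) (group_call LP lps (unit_oracle n h) g) minimize
           (minimization_start n M) (T n) n
           (\<lambda>t. set_arr t ''result'' 0 \<subseteq> {..<n} \<and>
             (\<forall>A \<subseteq> {..<n}. h (set_arr t ''result'' 0) \<le> h A))"
      unfolding T_def by (intro runs_minimize[OF assms(4) LP])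
    then obtain k t where run:
      "exec LP lps (unit_oracle n h) (group_call LP lps (unit_oracle n h) g)
         minimize (minimization_start n M) k n t" "k \<le> T n"
      and res: "set_arr t ''result'' 0 \<subseteq> {..<n}"
        "\<forall>A \<subseteq> {..<n}. h (set_arr t ''result'' 0) \<le> h A"
      unfolding runs_def by (elim exE conjE)
    have "\<psi> (el ` set_arr t ''result'' 0) \<le> \<psi> A" if "A \<subseteq> E" for A
    proof -
      have "A \<subseteq> el ` {..<n}"
        using that bij_betw_imp_surj_on[OF E(2)] by simp
      then obtain I where "I \<subseteq> {..<n}" "A = el ` I"
        by (rule subset_imageE)
      with res(2) show ?thesis
        by (simp add: h_def)
    qed
    then have "\<psi> (el ` set_arr t ''result'' 0) = Min (\<psi> ` Pow E)"
      using E(1) image[OF res(1)] by (intro Min_eqI[symmetric]) auto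
    moreover have "set_function_oracle n el \<psi> = unit_oracle n h"
      by (simp add: set_function_oracle_def h_def[abs_def])
    ultimately show "\<exists>k t A.
         exec LP lps (set_function_oracle n el \<psi>)
           (group_call LP lps (set_function_oracle n el \<psi>) g)
           minimize (minimization_start n M) k n t \<and>
         k \<le> T n \<and>
         A = el ` set_arr t ''result'' 0 \<and> A \<subseteq> E \<and> \<psi> A = Min (\<psi> ` Pow E)"
      using run image[OF res(1)]
      by (intro exI[of _ k] exI[of _ t] exI[of _ "el ` set_arr t ''result'' 0"]) simp
  qed
qed

end
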